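(* Let $1\le p<N$ or $p=N=1$. Then there exist two constants $0<\alpha = \alpha(N,p)\le 1$ and $\beta=\beta(N,p)\ge 1$, depending only on $N$ and $p$, such that for every open set $\Omega\subseteq\mathbb{R}^N$ we have \[ R^{\rm MS}_{p,\alpha\cdot\gamma}(\Omega)\le R_{p,\gamma}(\Omega),\qquad\text{for every}\ 0<\gamma<1, \] and \[ R_{p,\gamma}(\Omega)\le R^{\rm MS}_{p,\beta \cdot\gamma}(\Omega),\qquad\text{for every}\ 0<\gamma<\frac{1}{\beta}. \] Moreover, for $N\ge 2$ these constants satisfy \[ \lim_{p\nearrow N}\alpha(N,p)=0\qquad\text{and}\qquad \lim_{p\nearrow N}\beta(N,p)=+\infty. \]
   Context: $B_r(x)$ is the open Euclidean ball in $\mathbb{R}^N$ of center $x$ and radius $r$; $C^\infty_0(E)$ is the space of smooth functions with compact support in $E$. Suprema of sets of positive numbers are taken in $[0,+\infty]$. Relative $p$-capacity: for $E\subseteq \mathbb{R}^N$ open and $\Sigma\subseteq E$ compact, $\mathrm{cap}_p(\Sigma;E)=\inf\{\int_E |\nabla \varphi|^p\,dx : \varphi\in C^\infty_0(E),\ \varphi \ge 1 \text{ on } \Sigma\}$. Absolute homogeneous $p$-capacity: for $\Sigma\subseteq\mathbb{R}^N$ compact, $\mathrm{cap}_p(\Sigma)=\mathrm{cap}_p(\Sigma;\mathbb{R}^N)$. Capacitary inradius: for $0<\gamma<1$, \[ R_{p,\gamma}(\Omega)=\sup\Big\{r>0 : \exists x_0\in\mathbb{R}^N \text{ such that } \mathrm{cap}_p\big(\overline{B_r(x_0)}\setminus\Omega;B_{2r}(x_0)\big)\le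 \gamma\,\mathrm{cap}_p\big(\overline{B_r(x_0)};B_{2r}(x_0)\big)\Big\}. \] Maz'ya–Shubin capacitary inradius: for $0<\gamma<1$, \[ R^{\rm MS}_{p,\gamma}(\Omega)=\sup\Big\{r>0 : \exists x_0\in\mathbb{R}^N \text{ such that } \mathrm{cap}_p\big(\overline{B_r(x_0)}\setminus\Omega\big)\le \gamma\,\mathrm{cap}_p\big(\overline{B_r(x_0)}\big)\Big\}. \] *)

theory Defs
  imports "HOL-Analysis.Analysis"
begin

(* Meaningful only at points of differentiability; elsewhere THE returns an unspecified vector. *)
definition grad :: "(real^'n \<Rightarrow> real) \<Rightarrow> real^'n \<Rightarrow> real^'n" where
  "grad f x = (THE D. GDERIV f x :> D)"

primrec C_class :: "nat \<Rightarrow> (real^'n \<Rightarrow> real) \<Rightarrow> bool" where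
  "C_class 0 f \<longleftrightarrow> continuous_on UNIV f"
| "C_class (Suc k) f \<longleftrightarrow> (\<forall>x. f differentiable (at x)) \<and> (\<forall>i. C_class k (\<lambda>x. grad f x $ i))"

definition smooth :: "(real^'n \<Rightarrow> real) \<Rightarrow> bool" where
  "smooth f \<longleftrightarrow> (\<forall>k. C_class k f)"

(* For open E: a smooth function with compact support in E is identified with its
   (smooth) extension by zero to the whole space. *)
definition test_functions :: "(real^'n) set \<Rightarrow> (real^'n \<Rightarrow> real) set" where
  "test_functions E = {\<phi>. smooth \<phi> \<and> compact (closure {x. \<phi> x \<noteq> 0}) \<and> closure {x. \<phi> x \<noteq> 0} \<subseteq> E}"

(* Used for E open and \<Sigma> \<subseteq> E compact. *)
definition rel_cap :: "real \<Rightarrow> (real^'n) set \<Rightarrow> (real^'n) set \<Rightarrow> ennreal" where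
  "rel_cap p \<Sigma> E =
     (INF \<phi> \<in> {\<phi> \<in> test_functions E. \<forall>x\<in>\<Sigma>. \<phi> x \<ge> 1}.
        \<integral>\<^sup>+x\<in>E. ennreal (norm (grad \<phi> x) powr p) \<partial>lborel)"

definition abs_cap :: "real \<Rightarrow> (real^'n) set \<Rightarrow> ennreal" where
  "abs_cap p \<Sigma> = rel_cap p \<Sigma> UNIV"

(* Suprema in ennreal, so that the supremum of the empty set is 0. *)
definition cap_inradius :: "real \<Rightarrow> real \<Rightarrow> (real^'n) set \<Rightarrow> ennreal" where
  "cap_inradius p \<gamma> \<Omega> =
     (SUP r \<in> {r :: real. r > 0 \<and> (\<exists>x\<^sub>0.
         rel_cap p (cball x\<^sub>0 r - \<Omega>) (ball x\<^sub>0 (2 * r))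
           \<le> ennreal \<gamma> * rel_cap p (cball x\<^sub>0 r) (ball x\<^sub>0 (2 * r)))}. ennreal r)"

definition MS_inradius :: "real \<Rightarrow> real \<Rightarrow> (real^'n) set \<Rightarrow> ennreal" where
  "MS_inradius p \<gamma> \<Omega> =
     (SUP r \<in> {r :: real. r > 0 \<and> (\<exists>x\<^sub>0.
         abs_cap p (cball x\<^sub>0 r - \<Omega>) \<le> ennreal \<gamma> * abs_cap p (cball x\<^sub>0 r))}. ennreal r)"

lemma GDERIV_grad:
  assumes "f differentiable (at x)"
  shows "GDERIV f x :> grad f x"
proof -
  obtain f' where f': "(f has_derivative f') (at x)"
    using assms by (auto simp: differentiable_def)
  then have lin: "linear f'"
    by (rule has_derivative_linear)
  have "f' = (\<lambda>h. h \<bullet> adjoint f' 1)"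
    using adjoint_works[OF lin, of _ 1] by (auto simp: fun_eq_iff)
  then have G: "GDERIV f x :> adjoint f' 1"
    using f' by (simp add: gderiv_def)
  moreover have "D = D'" if "GDERIV f x :> D" "GDERIV f x :> D'" for D D'
  proof -
    have "(\<lambda>h. h \<bullet> D) = (\<lambda>h. h \<bullet> D')"
      using that by (auto simp: gderiv_def intro: has_derivative_unique)
    then show ?thesis
      by (metis vector_eq_ldot)
  qed
  ultimately show ?thesis
    unfolding grad_def by (metis theI)
qed

end

theory Submission
  imports Defs
begin

text \<open>
  The two inradii differ only in whether sets \<open>S \<subseteq> cball x r\<close> are measured by their capacity relative
  to \<open>ball x (2 * r)\<close> or by their absolute capacity. Both conclusions follow once these capacities are
  comparable, with a constant \<open>K\<close> independent of \<open>S\<close>, \<open>x\<close> and \<open>r\<close>: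
  \<open>abs_cap p S \<le> rel_cap p S (ball x (2 * r)) \<le> K * abs_cap p S\<close>.
  Applying the comparison once to \<open>cball x r - \<Omega>\<close> and once to \<open>cball x r\<close> transforms the condition
  defining one radius into the condition defining the other, at the cost of a factor \<open>K\<close> in \<open>\<gamma>\<close>
  (\<open>MS_inradius_le_cap_inradius\<close>, \<open>cap_inradius_le_MS_inradius\<close>).

  The left inequality holds because there are fewer competitors in a smaller domain. For the right one
  (\<open>rel_cap_le_abs_cap\<close>), a competitor \<open>\<phi>\<close> on the whole space is multiplied by a smooth cutoff
  \<open>\<eta>\<close> with \<open>\<eta> \<ge> 1\<close> on \<open>cball x r\<close>, support in \<open>ball x (2 * r)\<close> and gradient of order \<open>1 / r\<close>.
  The product rule leaves the term \<open>\<bar>\<phi>\<bar> / r\<close>, which the Poincare type inequality \<open>Poincare_ball\<close>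
  controls: the integral of \<open>\<bar>\<phi>\<bar> powr p\<close> over a ball of radius \<open>R\<close> is at most a constant times
  \<open>R powr p\<close> times the integral of \<open>norm (grad \<phi>) powr p\<close> over the whole space.

  That inequality is obtained by integrating along rays. As \<open>\<phi>\<close> has compact support,
  \<open>\<bar>\<phi> (x + z)\<bar>\<close> is at most the integral of \<open>norm z * norm (grad \<phi> (x + t *\<^sub>R z))\<close> over \<open>t \<ge> 1\<close>.
  Jensen's inequality for the probability density \<open>(a - 1) * t powr (- a)\<close> on \<open>t \<ge> 1\<close> turns this into
  a bound for the \<open>p\<close>-th power, with weight \<open>t powr (a * (p - 1))\<close>. Two things are needed of the
  exponent: \<open>a > 1\<close>, and \<open>a * (p - 1) \<le> N - 1\<close>, so that the weight is at most \<open>t ^ (N - 1)\<close>. Such an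
  \<open>a\<close> exists exactly when \<open>p < N\<close> or \<open>p = N = 1\<close>, which is where the hypothesis on \<open>p\<close> enters. After
  exchanging the integrals and substituting \<open>w = t *\<^sub>R z\<close>, what remains is the kernel
  \<open>norm w powr p * t powr (- p - 1)\<close> on \<open>t > norm w / R\<close>, whose \<open>t\<close>-integral is the constant
  \<open>R powr p / p\<close> (\<open>kernel_bound\<close>).

  The limits as \<open>p\<close> tends to \<open>N\<close> come from the freedom in the choice of constants: both inequalities
  survive when \<open>\<alpha>\<close> decreases and \<open>\<beta>\<close> increases, so \<open>K\<close> may be replaced by its maximum with
  \<open>1 / (N - p)\<close>.
\<close>

section \<open>Smooth functions and their gradients\<close>

lemma grad_eqI: "GDERIV f x :> D \<Longrightarrow> grad f x = D"
  using GDERIV_grad[of f x]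
  by (metis (no_types, lifting) gderiv_def differentiableI has_derivative_unique vector_eq_ldot)

lemma C_class_differentiable: "C_class (Suc k) f \<Longrightarrow> f differentiable (at x)" by simp

lemma C_class_Suc_D: "C_class (Suc k) f \<Longrightarrow> C_class k f"
proof (induction k arbitrary: f)
  case 0
  then show ?case
    by (simp add: continuous_on_eq_continuous_at differentiable_imp_continuous_within)
next
  case (Suc k)
  then show ?case by (metis C_class.simps(2))
qed

lemma C_class_const: "C_class k (\<lambda>x::real^'n. c)"
proof (induction k arbitrary: c)
  case (Suc k)
  have "grad (\<lambda>x::real^'n. c) x = 0" for x by (rule grad_eqI) (rule GDERIV_const)
  with Suc show ?case by simp
qed simp

lemma C_class_add:
  "C_class k f \<Longrightarrow> C_class k g \<Longrightarrow> C_class k (\<lambda>x. f x + g x)"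
proof (induction k arbitrary: f g)
  case 0 then show ?case by (simp add: continuous_on_add)
next
  case (Suc k)
  have "grad (\<lambda>x. f x + g x) x = grad f x + grad g x" for x
    by (rule grad_eqI, rule GDERIV_add) (use Suc.prems in \<open>auto intro!: GDERIV_grad\<close>)
  with Suc show ?case by simp
qed

lemma grad_mult:
  assumes "f differentiable (at x)" "g differentiable (at x)"
  shows "grad (\<lambda>x. f x * g x) x = f x *\<^sub>R grad g x + g x *\<^sub>R grad f x"
  by (rule grad_eqI, rule GDERIV_mult) (use assms in \<open>auto intro!: GDERIV_grad\<close>)

lemma C_class_mult:
  "C_class k f \<Longrightarrow> C_class k g \<Longrightarrow> C_class k (\<lambda>x. f x * g x)"
proof (induction k arbitrary: f g)
  case 0 then show ?case by (simp add: continuous_on_mult)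
next
  case (Suc k)
  have f: "C_class k f" and g: "C_class k g" using Suc.prems C_class_Suc_D by blast+
  have "C_class k (\<lambda>x. f x * grad g x $ i + g x * grad f x $ i)" for i
    using Suc.prems f g by (intro C_class_add Suc.IH) auto
  moreover have "grad (\<lambda>x. f x * g x) x $ i = f x * grad g x $ i + g x * grad f x $ i" for i x
    using Suc.prems by (simp add: grad_mult)
  ultimately show ?case using Suc.prems by simp
qed

lemma smooth_mult: "smooth f \<Longrightarrow> smooth g \<Longrightarrow> smooth (\<lambda>x. f x * g x)"
  by (simp add: smooth_def C_class_mult)

lemma smooth_GDERIV: "smooth \<phi> \<Longrightarrow> GDERIV \<phi> x :> grad \<phi> x"
  by (metis smooth_def C_class_differentiable GDERIV_grad)

lemma smooth_continuous: "smooth \<phi> \<Longrightarrow> continuous_on S \<phi>"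
  by (metis smooth_def C_class.simps(1) continuous_on_subset subset_UNIV)

lemma smooth_continuous_grad:
  fixes \<phi> :: "real^'n \<Rightarrow> real"
  assumes "smooth \<phi>" shows "continuous_on S (grad \<phi>)"
proof -
  have "C_class (Suc 0) \<phi>" using assms by (auto simp: smooth_def)
  then have "continuous_on UNIV (\<lambda>x. \<chi> i. grad \<phi> x $ i)"
    by (intro continuous_on_vec_lambda) simp
  then show ?thesis by (auto intro: continuous_on_subset)
qed

lemma C_class_coordinate: "C_class k (\<lambda>x::real^'n. x $ i)"
proof (cases k)
  case (Suc j)
  have "grad (\<lambda>x::real^'n. x $ i) x = axis i 1" for x
  proof (rule grad_eqI)
    have "((\<lambda>x::real^'n. x $ i) has_derivative (\<lambda>h. h $ i)) (at x)"
      by (intro bounded_linear_imp_has_derivative bounded_linear_vec_nth)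
    then show "GDERIV (\<lambda>x::real^'n. x $ i) x :> axis i 1"
      by (simp add: gderiv_def inner_axis)
  qed
  then show ?thesis using Suc
    by (simp add: C_class_const bounded_linear_imp_differentiable bounded_linear_vec_nth)
qed (simp add: continuous_intros)

section \<open>A smooth cutoff\<close>

text \<open>All derivatives of the flat function \<open>exp_inv 0\<close> are linear combinations of this family, whose span
  is closed under differentiation. Smoothness of the cutoff is then a plain induction.\<close>

definition exp_inv :: "nat \<Rightarrow> real \<Rightarrow> real" where
  "exp_inv m x = (if x > 0 then exp (- 1 / x) / x ^ m else 0)"

lemma power_div_fact_le_exp: "0 \<le> (u::real) \<Longrightarrow> u ^ n / fact n \<le> exp u"
proof -
  assume u: "0 \<le> u"
  have "(\<Sum>k\<in>{n}. u ^ k /\<^sub>R fact k) \<le> (\<Sum>k. u ^ k /\<^sub>R fact k)"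
    using u by (intro sum_le_suminf summable_exp_generic) auto
  then show ?thesis by (simp add: exp_def divide_inverse mult.commute)
qed

lemma exp_inv_nonneg: "0 \<le> exp_inv m x" by (simp add: exp_inv_def)

text \<open>Bounding \<open>exp (1 / x)\<close> below by the term of degree \<open>m + j\<close> of its series. The case \<open>j = 0\<close> bounds
  \<open>exp_inv m\<close> uniformly, \<open>j = 2\<close> gives its derivative at \<open>0\<close>.\<close>

lemma exp_inv_bound: "exp_inv m x \<le> fact (m + j) * \<bar>x\<bar> ^ j"
proof (cases "x > 0")
  case True
  have "(1/x) ^ (m + j) / fact (m + j) \<le> exp (1/x)" by (rule power_div_fact_le_exp) (use True in simp)
  then have "1 / x ^ m \<le> fact (m + j) * x ^ j * exp (1/x)"
    using True by (simp add: field_simps power_add)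
  from mult_right_mono[OF this, of "exp (-1/x)"]
  have "1 / x ^ m * exp (-1/x) \<le> fact (m + j) * x ^ j * (exp (1/x) * exp (-1/x))"
    by (simp add: mult.assoc)
  also have "exp (1/x) * exp (-1/x) = 1" by (simp flip: exp_add)
  finally show ?thesis using True by (simp add: exp_inv_def)
qed (simp add: exp_inv_def)

lemma DERIV_exp_inv:
  "(exp_inv m has_real_derivative exp_inv (m + 2) x - real m * exp_inv (m + 1) x) (at x)"
proof -
  consider "x > 0" | "x < 0" | "x = 0" by linarith
  then show ?thesis
  proof cases
    case 1
    have "((\<lambda>x. exp (- 1 / x) / x ^ m) has_real_derivative
        (exp (- 1 / x) * (1 / x^2) * x ^ m - exp (- 1 / x) * (real m * x ^ (m - 1))) / (x ^ m * x ^ m)) (at x)"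
      using 1 by (auto intro!: derivative_eq_intros simp: power2_eq_square field_simps)
    also have "(exp (- 1 / x) * (1 / x^2) * x ^ m - exp (- 1 / x) * (real m * x ^ (m - 1))) / (x ^ m * x ^ m)
       = exp_inv (m + 2) x - real m * exp_inv (m + 1) x"
      using 1 by (cases m) (simp_all add: exp_inv_def field_simps power2_eq_square)
    finally show ?thesis
      by (rule DERIV_cong_ev[THEN iffD1, rotated -1])
        (use 1 in \<open>auto simp: exp_inv_def intro!: eventually_mono[OF eventually_gt_at_top] eventually_nhds_in_open[of "{0<..}", THEN eventually_mono]\<close>)
  next
    case 2
    have "eventually (\<lambda>y. exp_inv m y = 0) (nhds x)"
      using eventually_nhds_in_open[of "{..<0}" x] 2 by (auto simp: exp_inv_def elim!: eventually_mono)
    then have "(exp_inv m has_real_derivative 0) (at x)"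
      by (subst DERIV_cong_ev[OF refl _ refl]) auto
    with 2 show ?thesis by (simp add: exp_inv_def)
  next
    case 3
    have "((\<lambda>h. fact (m + 2) * \<bar>h\<bar>) \<longlongrightarrow> 0) (at (0::real))"
      by (intro tendsto_mult_right_zero tendsto_rabs_zero tendsto_ident_at)
    then have "((\<lambda>h. exp_inv m h / h) \<longlongrightarrow> 0) (at 0)"
    proof (rule Lim_null_comparison[rotated], intro always_eventually allI)
      fix h :: real
      show "norm (exp_inv m h / h) \<le> fact (m + 2) * \<bar>h\<bar>"
      proof (cases "h = 0")
        case False
        have "exp_inv m h \<le> (fact (m + 2) * \<bar>h\<bar>) * \<bar>h\<bar>"
          using exp_inv_bound[of m h 2] unfolding power2_eq_square mult.assoc .
        with False show ?thesis
          using exp_inv_nonneg[of m h]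
          by (simp del: abs_mult_self_eq fact_Suc add: pos_divide_le_eq)
      qed simp
    qed
    with 3 show ?thesis by (simp add: DERIV_def exp_inv_def)
  qed
qed

text \<open>The radius \<open>sqrt 2 * r\<close> of the support lies strictly between \<open>r\<close> and \<open>2 * r\<close>. Using the squared
  norm keeps the function smooth at the center.\<close>

definition cutoff :: "nat \<Rightarrow> real^'n \<Rightarrow> real \<Rightarrow> real^'n \<Rightarrow> real" where
  "cutoff m x r y = exp_inv m (2 - (norm (y - x) / r)\<^sup>2)"

lemma GDERIV_cutoff:
  "GDERIV (cutoff m x r) y :>
     (exp_inv (m + 2) (2 - (norm (y - x) / r)\<^sup>2) - real m * exp_inv (m + 1) (2 - (norm (y - x) / r)\<^sup>2))
       *\<^sub>R ((- 2 / r\<^sup>2) *\<^sub>R (y - x))"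
proof -
  have "GDERIV (\<lambda>y. 2 - (norm (y - x) / r)\<^sup>2) y :> (- 2 / r\<^sup>2) *\<^sub>R (y - x)"
  proof -
    have *: "(\<lambda>y. 2 - (norm (y - x) / r)\<^sup>2) = (\<lambda>y. 2 - ((y - x) \<bullet> (y - x)) * (1 / r\<^sup>2))"
      by (simp add: power_divide power2_norm_eq_inner)
    show ?thesis unfolding gderiv_def *
      by (auto intro!: derivative_eq_intros simp: fun_eq_iff inner_commute divide_inverse algebra_simps)
  qed
  from GDERIV_DERIV_compose[OF this DERIV_exp_inv] show ?thesis
    by (simp add: cutoff_def[abs_def])
qed

text \<open>The induction runs over all \<open>m\<close> simultaneously, since differentiating raises \<open>m\<close>.\<close>

lemma C_class_cutoff: "C_class k (cutoff m x r)"
proof (induction k arbitrary: m)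
  case 0
  then show ?case
    using GDERIV_cutoff[of m x r]
    by (auto simp: gderiv_def continuous_on_eq_continuous_at intro!: has_derivative_continuous)
next
  case (Suc k)
  have "grad (cutoff m x r) y $ i =
     (cutoff (m + 2) x r y + (- real m) * cutoff (m + 1) x r y) * ((- 2 / r\<^sup>2) * (y $ i + - x $ i))" for y i
    by (simp add: grad_eqI[OF GDERIV_cutoff] cutoff_def algebra_simps diff_divide_distrib)
  moreover have "C_class k (\<lambda>y. (cutoff (m + 2) x r y + (- real m) * cutoff (m + 1) x r y) * ((- 2 / r\<^sup>2) * (y $ i + - x $ i)))" for i
    by (intro C_class_mult C_class_add Suc.IH C_class_const C_class_coordinate)
  moreover have "cutoff m x r differentiable (at y)" for y
    using GDERIV_cutoff[of m x r y] by (auto simp: gderiv_def differentiable_def)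
  ultimately show ?case by simp
qed

section \<open>A Poincare inequality by integration along rays\<close>

text \<open>Young's inequality in the form that \<open>h \<mapsto> h powr p\<close> lies above its tangent at \<open>v\<close>.\<close>

lemma Young_tangent:
  fixes p v h :: real
  assumes p: "1 \<le> p" and v: "0 \<le> v" and h: "0 \<le> h"
  shows "p * v powr (p - 1) * h \<le> h powr p + (p - 1) * v powr p"
proof (cases "p = 1")
  case True
  then show ?thesis using h by (cases "v = 0") auto
next
  case False
  with p have p1: "p > 1" by simp
  define q where "q = p / (p - 1)"
  have q: "q > 1" "1 / p + 1 / q = 1" "p / q = p - 1" "(p - 1) * q = p"
    using p1 by (auto simp: q_def field_simps)
  have "p * (h * v powr (p - 1)) \<le> p * (h powr p / p + (v powr (p - 1)) powr q / q)"
    using p1 by (intro mult_left_mono Youngs_inequality) (use q h in auto)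
  also have "\<dots> = h powr p + (p / q) * v powr ((p - 1) * q)"
    using p1 by (simp add: powr_powr ring_distribs)
  finally show ?thesis unfolding q by (simp add: mult_ac)
qed

text \<open>The pointwise form of Jensen's inequality for the density \<open>(a - 1) * t powr (- a)\<close>: the tangent
  inequality is applied to \<open>c * g\<close> divided by the density and then multiplied by the density again.
  Integrated over \<open>t \<ge> 1\<close>, the last term becomes \<open>(p - 1) * v powr p\<close> and can be absorbed.\<close>

lemma Young_weighted:
  fixes p a v c g t :: real
  assumes p: "1 \<le> p" and v: "0 \<le> v" and c: "0 \<le> c" and g: "0 \<le> g" and a: "1 < a" and t: "1 \<le> t"
    and n: "a * (p - 1) \<le> real n"
  shows "p * v powr (p - 1) * (c * g) \<le>
     (a - 1) powr (1 - p) * c powr p * (g powr p * t ^ n) + (p - 1) * v powr p * ((a - 1) * t powr (- a))"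
proof -
  \<comment> \<open>The weight \<open>w\<close> is the density, and \<open>h * w = c * g\<close>.\<close>
  define h where "h = c * g * t powr a / (a - 1)"
  define w where "w = (a - 1) * t powr (- a)"
  have w: "0 \<le> w" using a t by (simp add: w_def)
  have hw: "h * w = c * g"
    using a t by (simp add: h_def w_def flip: powr_add)
  have h: "0 \<le> h" using a c g by (simp add: h_def)
  have "p * v powr (p - 1) * h * w \<le> (h powr p + (p - 1) * v powr p) * w"
    using Young_tangent[OF p v h] w by (rule mult_right_mono)
  also have "h powr p * w = (a - 1) powr (1 - p) * c powr p * (g powr p * t powr (a * (p - 1)))"
  proof -
    have "h powr p * w = c powr p * g powr p * (t powr (a * p) * t powr (- a)) * ((a - 1) powr 1 * (a - 1) powr (- p))"
      using a c g t by (simp add: h_def w_def powr_mult powr_divide powr_powr powr_minus divide_inverse inverse_powr)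
    also have "\<dots> = c powr p * g powr p * t powr (a * p + - a) * (a - 1) powr (1 + - p)"
      by (simp only: powr_add)
    finally show ?thesis by (simp add: algebra_simps)
  qed
  then have "(h powr p + (p - 1) * v powr p) * w
      = (a - 1) powr (1 - p) * c powr p * (g powr p * t powr (a * (p - 1))) + (p - 1) * v powr p * w"
    by (simp add: algebra_simps)
  also have "t powr (a * (p - 1)) \<le> t ^ n"
    using powr_mono[OF n t] t by (simp add: powr_realpow)
  finally show ?thesis using hw
    by (simp add: w_def mult.assoc mult_left_mono)
qed

lemma nn_integral_powr_tail:
  fixes m s :: real
  assumes m: "0 < m" and s: "0 < s"
  shows "(\<integral>\<^sup>+t. ennreal (s * t powr (- s - 1)) * indicator {m..} t \<partial>lborel) = ennreal (m powr (- s))"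
proof -
  have "(\<integral>\<^sup>+t. ennreal (s * t powr (- s - 1)) * indicator {m..} t \<partial>lborel) = ennreal (0 - - (m powr - s))"
  proof (rule nn_integral_FTC_atLeast)
    show "((\<lambda>t. - (t powr - s)) \<longlongrightarrow> 0) at_top"
      using tendsto_minus[OF tendsto_neg_powr[OF _ filterlim_ident, of "-s"]] s by simp
    fix t :: real assume "m \<le> t"
    then have "t > 0" using m by simp
    then show "((\<lambda>t. - (t powr - s)) has_real_derivative s * t powr (- s - 1)) (at t)"
      by (auto intro!: derivative_eq_intros)
  qed (use s in auto)
  then show ?thesis by simp
qed

lemma nn_integral_affine:
  fixes f :: "'a::euclidean_space \<Rightarrow> ennreal"
  assumes [measurable]: "f \<in> borel_measurable borel" and c: "c \<noteq> 0"
  shows "(\<integral>\<^sup>+x. f x \<partial>lborel) = ennreal (\<bar>c\<bar> ^ DIM('a)) * (\<integral>\<^sup>+x. f (t + c *\<^sub>R x) \<partial>lborel)"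
  by (subst lborel_affine[OF c, of t])
     (simp add: nn_integral_density nn_integral_distr nn_integral_cmult ennreal_power)

text \<open>The fundamental theorem of calculus on a ray that leaves the support of \<open>\<phi>\<close>. For \<open>z = 0\<close> the ray
  degenerates and the bound fails.\<close>

lemma abs_le_ray_integral:
  fixes \<phi> :: "real^'n \<Rightarrow> real"
  assumes smooth: "smooth \<phi>" and bdd: "bounded {x. \<phi> x \<noteq> 0}" and z: "z \<noteq> 0"
  shows "ennreal \<bar>\<phi> (x + z)\<bar> \<le>
    (\<integral>\<^sup>+t. ennreal (norm z * norm (grad \<phi> (x + t *\<^sub>R z))) * indicator {1..} t \<partial>lborel)"
proof -
  obtain B where B: "\<And>y. \<phi> y \<noteq> 0 \<Longrightarrow> norm y \<le> B"
    using bdd by (auto simp: bounded_iff)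
  \<comment> \<open>The point at parameter \<open>T\<close> on the ray has norm at least \<open>B + 1\<close>.\<close>
  define T where "T = max 1 ((B + 1 + norm x) / norm z)"
  have T: "1 \<le> T" by (simp add: T_def)
  have "(B + 1 + norm x) / norm z \<le> T" by (simp add: T_def)
  then have "B + 1 + norm x \<le> T * norm z" using z by (simp add: pos_divide_le_eq)
  also have "\<dots> = norm (T *\<^sub>R z)" using T by simp
  also have "\<dots> \<le> norm (x + T *\<^sub>R z) + norm x" by (metis add_diff_cancel_left' norm_triangle_ineq4)
  finally have "\<phi> (x + T *\<^sub>R z) = 0" using B[of "x + T *\<^sub>R z"] by auto
  define f where "f t = z \<bullet> grad \<phi> (x + t *\<^sub>R z)" for t
  define c where "c t = norm z * norm (grad \<phi> (x + t *\<^sub>R z))" for t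
  have cont: "continuous_on S (\<lambda>t. grad \<phi> (x + t *\<^sub>R z))" for S
    by (rule continuous_on_compose2[OF smooth_continuous_grad[OF smooth, of UNIV]])
       (auto intro!: continuous_intros)
  have "((\<lambda>t. \<phi> (x + t *\<^sub>R z)) has_vector_derivative f t) (at t within {1..T})" for t
  proof -
    have "(\<phi> has_derivative (\<lambda>h. h \<bullet> grad \<phi> (x + t *\<^sub>R z))) (at (x + t *\<^sub>R z))"
      using smooth_GDERIV[OF smooth] by (simp add: gderiv_def)
    then have "((\<lambda>t. \<phi> (x + t *\<^sub>R z)) has_derivative (\<lambda>s. (s *\<^sub>R z) \<bullet> grad \<phi> (x + t *\<^sub>R z))) (at t within {1..T})"
      by (rule has_derivative_compose[rotated]) (auto intro!: derivative_eq_intros)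
    then show ?thesis by (simp add: has_vector_derivative_def f_def)
  qed
  from fundamental_theorem_of_calculus[OF T this]
  have f: "(f has_integral (\<phi> (x + T *\<^sub>R z) - \<phi> (x + 1 *\<^sub>R z))) {1..T}" by simp
  have cc: "continuous_on S c" for S unfolding c_def by (intro continuous_intros cont)
  have c: "set_integrable lborel {1..T} c"
    using borel_integrable_atLeastAtMost'[OF cc] .
  have "\<bar>\<phi> (x + z)\<bar> = \<bar>integral {1..T} f\<bar>"
    using integral_unique[OF f] \<open>\<phi> (x + T *\<^sub>R z) = 0\<close> by simp
  also have "\<dots> \<le> integral {1..T} c"
    using integral_norm_bound_integral[of f "{1..T}" c] f integrable_continuous_interval[OF cc]
      Cauchy_Schwarz_ineq2 by (auto simp: f_def c_def has_integral_integrable)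
  also have "\<dots> = (LINT t:{1..T}|lborel. c t)"
    using set_borel_integral_eq_integral[OF c] by simp
  finally have "ennreal \<bar>\<phi> (x + z)\<bar> \<le> ennreal (LINT t|lborel. indicator {1..T} t *\<^sub>R c t)"
    by (simp add: set_lebesgue_integral_def ennreal_leI)
  also have "\<dots> = (\<integral>\<^sup>+t. ennreal (indicator {1..T} t *\<^sub>R c t) \<partial>lborel)"
    using c by (subst nn_integral_eq_integral) (auto simp: set_integrable_def c_def)
  also have "\<dots> \<le> (\<integral>\<^sup>+t. ennreal (c t) * indicator {1..} t \<partial>lborel)"
    by (intro nn_integral_mono) (auto simp: indicator_def)
  finally show ?thesis by (simp add: c_def)
qed

text \<open>With \<open>v = \<bar>\<phi> (x + z)\<bar>\<close>, integrating \<open>Young_weighted\<close> along the ray gives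
  \<open>p * v powr p \<le> X + (p - 1) * v powr p\<close>, where \<open>X\<close> is the claimed bound; finiteness of \<open>v\<close> permits
  the subtraction.\<close>

lemma powr_le_ray_integral:
  fixes \<phi> :: "real^'n \<Rightarrow> real"
  assumes smooth: "smooth \<phi>" and bdd: "bounded {x. \<phi> x \<noteq> 0}" and z: "z \<noteq> 0"
    and p: "1 \<le> p" and a: "1 < a" and n: "a * (p - 1) \<le> real n"
  shows "ennreal (\<bar>\<phi> (x + z)\<bar> powr p) \<le> ennreal ((a - 1) powr (1 - p) * norm z powr p) *
    (\<integral>\<^sup>+t. ennreal (norm (grad \<phi> (x + t *\<^sub>R z)) powr p * t ^ n) * indicator {1..} t \<partial>lborel)"
    (is "_ \<le> ?X")
proof -
  define v where "v = \<bar>\<phi> (x + z)\<bar>"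
  define g where "g t = norm (grad \<phi> (x + t *\<^sub>R z))" for t
  have v: "0 \<le> v" by (simp add: v_def)
  have "continuous_on UNIV g"
    unfolding g_def by (intro continuous_intros continuous_on_compose2[OF smooth_continuous_grad[OF smooth, of UNIV]]) auto
  then have [measurable]: "g \<in> borel_measurable borel" by (rule borel_measurable_continuous_onI)
  have "ennreal (v powr p) + ennreal ((p - 1) * v powr p) = ennreal (p * v powr p)"
    using p v by (subst ennreal_plus[symmetric]) (auto simp: left_diff_distrib intro: mult_right_mono[of 1 p "v powr p", simplified])
  also have "\<dots> = ennreal (p * v powr (p - 1)) * ennreal v"
    using v p by (cases "v = 0") (simp_all add: powr_diff flip: ennreal_mult)
  also have "\<dots> \<le> ennreal (p * v powr (p - 1)) * (\<integral>\<^sup>+t. ennreal (norm z * g t) * indicator {1..} t \<partial>lborel)"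
    using abs_le_ray_integral[OF smooth bdd z, of x] by (intro mult_left_mono) (auto simp: v_def g_def)
  also have "\<dots> = (\<integral>\<^sup>+t. ennreal (p * v powr (p - 1)) * (ennreal (norm z * g t) * indicator {1..} t) \<partial>lborel)"
    by (intro nn_integral_cmult[symmetric]) measurable
  also have "\<dots> \<le> (\<integral>\<^sup>+t. ennreal ((a - 1) powr (1 - p) * norm z powr p) * (ennreal (g t powr p * t ^ n) * indicator {1..} t)
       + ennreal ((p - 1) * v powr p) * (ennreal ((a - 1) * t powr (- (a - 1) - 1)) * indicator {1..} t) \<partial>lborel)"
  proof (intro nn_integral_mono)
    fix t :: real
    show "ennreal (p * v powr (p - 1)) * (ennreal (norm z * g t) * indicator {1..} t)
      \<le> ennreal ((a - 1) powr (1 - p) * norm z powr p) * (ennreal (g t powr p * t ^ n) * indicator {1..} t)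
       + ennreal ((p - 1) * v powr p) * (ennreal ((a - 1) * t powr (- (a - 1) - 1)) * indicator {1..} t)"
    proof (cases "1 \<le> t")
      case True
      then show ?thesis
        using Young_weighted[OF p v norm_ge_zero[of z] _ a True n, of "g t"] p a
        by (simp add: g_def flip: ennreal_mult ennreal_plus)
    qed simp
  qed
  also have "\<dots> = ?X + ennreal ((p - 1) * v powr p)"
    using nn_integral_powr_tail[of 1 "a - 1"] a
    by (subst nn_integral_add) (auto simp: nn_integral_cmult g_def[symmetric])
  finally show ?thesis unfolding v_def by (simp add: add.commute[of ?X] add.commute[of _ "ennreal ((p - 1) * _)"] ennreal_add_left_cancel_le)
qed

text \<open>The restriction to the ball of radius \<open>R\<close> before the substitution \<open>w = t *\<^sub>R z\<close> becomes
  \<open>t > norm w / R\<close> after it. This lower bound for \<open>t\<close> compensates the growth of \<open>norm w powr p\<close>,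
  which makes the bound uniform in \<open>w\<close>.\<close>

lemma kernel_bound:
  fixes p R :: real and w :: "'a::real_normed_vector"
  assumes p: "1 \<le> p" and R: "0 < R"
  shows "(\<integral>\<^sup>+t. ennreal (norm w powr p * t powr (- p - 1)) * (indicator {..<R} (norm w / t) * indicator {1..} t) \<partial>lborel)
     \<le> ennreal (R powr p / p)"
proof (cases "w = 0")
  case False
  then have m: "0 < norm w / R" using R by simp
  have "(\<integral>\<^sup>+t. ennreal (norm w powr p * t powr (- p - 1)) * (indicator {..<R} (norm w / t) * indicator {1..} t) \<partial>lborel)
    \<le> (\<integral>\<^sup>+t. ennreal (norm w powr p / p) * (ennreal (p * t powr (- p - 1)) * indicator {norm w / R..} t) \<partial>lborel)"
    using p R by (intro nn_integral_mono)
      (auto simp: indicator_def field_simps simp flip: ennreal_mult)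
  also have "\<dots> = ennreal (norm w powr p / p) * ennreal ((norm w / R) powr (- p))"
    using nn_integral_powr_tail[OF m, of p] p by (simp add: nn_integral_cmult)
  also have "\<dots> = ennreal (R powr p / p)"
    using False R p by (simp add: powr_minus powr_divide flip: ennreal_mult)
  finally show ?thesis .
qed (use p in simp)

text \<open>The ray bound is integrated over the ball and the two integrals are exchanged twice: first to
  substitute \<open>w = t *\<^sub>R z\<close> for fixed \<open>t\<close>, then to evaluate the \<open>t\<close>-integral for fixed \<open>w\<close>. The
  Jacobian \<open>t powr (- N)\<close>, the weight \<open>t ^ (N - 1)\<close> and \<open>norm z powr p = t powr (- p) * norm w powr p\<close>
  combine to \<open>t powr (- p - 1)\<close>, in every dimension.\<close>

lemma Poincare_ball:
  fixes \<phi> :: "real^'n \<Rightarrow> real"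
  assumes smooth: "smooth \<phi>" and bdd: "bounded {x. \<phi> x \<noteq> 0}"
    and p: "1 \<le> p" and a: "1 < a" and n: "a * (p - 1) \<le> real (CARD('n) - 1)" and R: "0 < R"
  shows "(\<integral>\<^sup>+y\<in>ball x R. ennreal (\<bar>\<phi> y\<bar> powr p) \<partial>lborel) \<le>
     ennreal ((a - 1) powr (1 - p) * R powr p / p) * (\<integral>\<^sup>+y. ennreal (norm (grad \<phi> y) powr p) \<partial>lborel)"
proof -
  define A where "A = (a - 1) powr (1 - p)"
  define n where "n = CARD('n) - 1"
  define g where "g y = norm (grad \<phi> y) powr p" for y
  have A: "0 \<le> A" by (simp add: A_def)
  have CN: "CARD('n) = Suc n" by (simp add: n_def)
  have [measurable]: "\<phi> \<in> borel_measurable borel" "grad \<phi> \<in> borel_measurable borel"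
    using smooth by (auto intro!: borel_measurable_continuous_onI smooth_continuous smooth_continuous_grad)
  then have [measurable]: "g \<in> borel_measurable borel" unfolding g_def by measurable
  have "(\<integral>\<^sup>+y\<in>ball x R. ennreal (\<bar>\<phi> y\<bar> powr p) \<partial>lborel)
      = (\<integral>\<^sup>+z. ennreal (\<bar>\<phi> (x + z)\<bar> powr p) * indicator {..<R} (norm z) \<partial>lborel)"
    by (subst nn_integral_affine[where c = 1 and t = x]) (auto simp: dist_norm indicator_def)
  also have "\<dots> \<le> (\<integral>\<^sup>+z. ennreal A * (\<integral>\<^sup>+t. ennreal (norm z powr p * (g (x + t *\<^sub>R z) * t ^ n)) *
        (indicator {..<R} (norm z) * indicator {1..} t) \<partial>lborel) \<partial>lborel)"
  \<comment> \<open>The center of the ball, where the ray degenerates, is a null set.\<close>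
  proof (intro nn_integral_mono_AE eventually_mono[OF AE_lborel_singleton[of 0]])
    fix z :: "real^'n" assume z: "z \<noteq> 0"
    have "ennreal (\<bar>\<phi> (x + z)\<bar> powr p) \<le> ennreal (A * norm z powr p) *
        (\<integral>\<^sup>+t. ennreal (g (x + t *\<^sub>R z) * t ^ n) * indicator {1..} t \<partial>lborel)"
      using powr_le_ray_integral[OF smooth bdd z p a, of n x] assms(5) by (simp add: A_def g_def n_def)
    then have "ennreal (\<bar>\<phi> (x + z)\<bar> powr p) * indicator {..<R} (norm z) \<le> ennreal (A * norm z powr p) *
        (\<integral>\<^sup>+t. ennreal (g (x + t *\<^sub>R z) * t ^ n) * indicator {1..} t \<partial>lborel) * indicator {..<R} (norm z)"
      by (rule mult_right_mono) simp
    also have "\<dots> = ennreal A * (\<integral>\<^sup>+t. ennreal (norm z powr p) * indicator {..<R} (norm z) *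
        (ennreal (g (x + t *\<^sub>R z) * t ^ n) * indicator {1..} t) \<partial>lborel)"
      using A by (subst nn_integral_cmult) (auto simp: ennreal_mult mult_ac)
    also have "\<dots> = ennreal A * (\<integral>\<^sup>+t. ennreal (norm z powr p * (g (x + t *\<^sub>R z) * t ^ n)) *
        (indicator {..<R} (norm z) * indicator {1..} t) \<partial>lborel)"
      by (rule arg_cong[where f = "\<lambda>I. ennreal A * I"], rule nn_integral_cong)
         (auto simp: indicator_def ennreal_mult g_def)
    finally show "ennreal (\<bar>\<phi> (x + z)\<bar> powr p) * indicator {..<R} (norm z) \<le> \<dots>" .
  qed
  also have "\<dots> = ennreal A * (\<integral>\<^sup>+z. (\<integral>\<^sup>+t. ennreal (norm z powr p * (g (x + t *\<^sub>R z) * t ^ n)) *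
        (indicator {..<R} (norm z) * indicator {1..} t) \<partial>lborel) \<partial>lborel)"
    by (intro nn_integral_cmult) measurable
  also have "(\<integral>\<^sup>+z. (\<integral>\<^sup>+t. ennreal (norm z powr p * (g (x + t *\<^sub>R z) * t ^ n)) *
        (indicator {..<R} (norm z) * indicator {1..} t) \<partial>lborel) \<partial>lborel)
     = (\<integral>\<^sup>+t. (\<integral>\<^sup>+z. ennreal (norm z powr p * (g (x + t *\<^sub>R z) * t ^ n)) *
        (indicator {..<R} (norm z) * indicator {1..} t) \<partial>lborel) \<partial>lborel)"
    by (intro lborel_pair.Fubini') measurable
  also have "\<dots> = (\<integral>\<^sup>+t. (\<integral>\<^sup>+w. ennreal (g (x + w)) * (ennreal (norm w powr p * t powr (- p - 1)) *
        (indicator {..<R} (norm w / t) * indicator {1..} t)) \<partial>lborel) \<partial>lborel)"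
  proof (rule nn_integral_cong)
    fix t :: real
    show "(\<integral>\<^sup>+z. ennreal (norm z powr p * (g (x + t *\<^sub>R z) * t ^ n)) *
        (indicator {..<R} (norm z) * indicator {1..} t) \<partial>lborel)
      = (\<integral>\<^sup>+w. ennreal (g (x + w)) * (ennreal (norm w powr p * t powr (- p - 1)) *
        (indicator {..<R} (norm w / t) * indicator {1..} t)) \<partial>lborel)"
    proof (cases "1 \<le> t")
      case True
      then have t: "t > 0" by simp
      have real: "norm z powr p * (g (x + t *\<^sub>R z) * t ^ n)
           = t ^ CARD('n) * (g (x + t *\<^sub>R z) * (norm (t *\<^sub>R z) powr p * t powr (- p - 1)))" for z
        using t by (simp add: CN powr_mult powr_diff powr_minus field_simps)
      have "ennreal (norm z powr p * (g (x + t *\<^sub>R z) * t ^ n)) * (indicator {..<R} (norm z) * indicator {1..} t)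
           = ennreal (t ^ CARD('n)) * (ennreal (g (x + t *\<^sub>R z)) * (ennreal (norm (t *\<^sub>R z) powr p * t powr (- p - 1)) *
              (indicator {..<R} (norm (t *\<^sub>R z) / t) * indicator {1..} t)))" for z
        unfolding real using t
        by (subst ennreal_mult, simp, simp add: g_def, subst ennreal_mult) (auto simp: g_def mult.assoc)
      then show ?thesis
        using t by (subst (2) nn_integral_affine[where c = t and t = 0]) (auto simp: nn_integral_cmult)
    qed simp
  qed
  also have "\<dots> = (\<integral>\<^sup>+w. (\<integral>\<^sup>+t. ennreal (g (x + w)) * (ennreal (norm w powr p * t powr (- p - 1)) *
        (indicator {..<R} (norm w / t) * indicator {1..} t)) \<partial>lborel) \<partial>lborel)"
    by (intro lborel_pair.Fubini') measurable
  also have "\<dots> = (\<integral>\<^sup>+w. ennreal (g (x + w)) * (\<integral>\<^sup>+t. (ennreal (norm w powr p * t powr (- p - 1)) *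
        (indicator {..<R} (norm w / t) * indicator {1..} t)) \<partial>lborel) \<partial>lborel)"
    by (intro nn_integral_cong nn_integral_cmult) measurable
  also have "\<dots> \<le> (\<integral>\<^sup>+w. ennreal (g (x + w)) * ennreal (R powr p / p) \<partial>lborel)"
    by (intro nn_integral_mono mult_left_mono kernel_bound p R) simp
  also have "\<dots> = ennreal (R powr p / p) * (\<integral>\<^sup>+w. ennreal (g (x + w)) \<partial>lborel)"
    by (subst nn_integral_multc) (auto simp: mult.commute)
  also have "(\<integral>\<^sup>+w. ennreal (g (x + w)) \<partial>lborel) = (\<integral>\<^sup>+y. ennreal (g y) \<partial>lborel)"
    using nn_integral_affine[of "\<lambda>y. ennreal (g y)" 1 x] by simp
  finally show ?thesis
    using A p by (simp add: A_def g_def mult_left_mono ennreal_mult mult.assoc flip: times_divide_eq_right)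
qed

section \<open>Comparison of the two capacities\<close>

lemma grad_zero_outside_support:
  assumes "y \<notin> closure {x. \<phi> x \<noteq> 0}"
  shows "grad \<phi> y = 0"
proof (rule grad_eqI)
  have "eventually (\<lambda>z. z \<in> - closure {x. \<phi> x \<noteq> 0}) (nhds y)"
    using assms by (intro eventually_nhds_in_open) auto
  then have ev: "eventually (\<lambda>z. \<phi> z = 0) (nhds y)"
    by (rule eventually_mono) (use closure_subset[of "{x. \<phi> x \<noteq> 0}"] in blast)
  have "((\<lambda>_. 0) has_derivative (\<lambda>h. h \<bullet> 0)) (at y)" by simp
  then show "GDERIV \<phi> y :> 0"
    unfolding gderiv_def
  proof (rule has_derivative_transform_eventually)
    show "eventually (\<lambda>z. 0 = \<phi> z) (at y)" "0 = \<phi> y"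
      using ev by (auto simp: eventually_nhds_conv_at elim: eventually_mono)
  qed simp
qed

lemma energy_eq_energy_on_support:
  assumes "\<phi> \<in> test_functions E"
  shows "(\<integral>\<^sup>+x. ennreal (norm (grad \<phi> x) powr p) \<partial>lborel)
    = (\<integral>\<^sup>+x\<in>E. ennreal (norm (grad \<phi> x) powr p) \<partial>lborel)"
proof (intro nn_integral_cong)
  fix x
  show "ennreal (norm (grad \<phi> x) powr p) = ennreal (norm (grad \<phi> x) powr p) * indicator E x"
  proof (cases "x \<in> E")
    case False
    then have "x \<notin> closure {y. \<phi> y \<noteq> 0}"
      using assms unfolding test_functions_def by blast
    from grad_zero_outside_support[OF this] False show ?thesis by simp
  qed simp
qed

text \<open>A competitor in \<open>E\<close> is a competitor on the whole space, with the same energy because its gradient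
  vanishes off \<open>E\<close>.\<close>

lemma abs_cap_le_rel_cap: "abs_cap p S \<le> rel_cap p S E"
  unfolding abs_cap_def rel_cap_def
proof (intro INF_greatest)
  fix \<phi> assume \<phi>: "\<phi> \<in> {\<phi> \<in> test_functions E. \<forall>x\<in>S. 1 \<le> \<phi> x}"
  then have "\<phi> \<in> {\<phi> \<in> test_functions UNIV. \<forall>x\<in>S. 1 \<le> \<phi> x}"
    by (auto simp: test_functions_def)
  then have "(INF \<phi>\<in>{\<phi> \<in> test_functions UNIV. \<forall>x\<in>S. 1 \<le> \<phi> x}. \<integral>\<^sup>+x\<in>UNIV. ennreal (norm (grad \<phi> x) powr p) \<partial>lborel)
    \<le> (\<integral>\<^sup>+x\<in>UNIV. ennreal (norm (grad \<phi> x) powr p) \<partial>lborel)"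
    by (rule INF_lower)
  also have "\<dots> = (\<integral>\<^sup>+x\<in>E. ennreal (norm (grad \<phi> x) powr p) \<partial>lborel)"
    using energy_eq_energy_on_support[of \<phi> E p] \<phi> by simp
  finally show "(INF \<phi>\<in>{\<phi> \<in> test_functions UNIV. \<forall>x\<in>S. 1 \<le> \<phi> x}. \<integral>\<^sup>+x\<in>UNIV. ennreal (norm (grad \<phi> x) powr p) \<partial>lborel)
    \<le> \<dots>" .
qed

text \<open>The cutoff is normalized by the factor \<open>exp 1\<close> because \<open>exp_inv 0\<close> equals \<open>exp (- 1)\<close> at
  \<open>1\<close>, the smallest argument that occurs for points of \<open>cball x r\<close>. A lower bound by \<open>1\<close> on \<open>cball x r\<close>
  is all that the constraint on competitors asks for, so \<open>\<eta>\<close> may exceed \<open>1\<close>.\<close>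

lemma ball_cutoff_exists:
  fixes x :: "real^'n"
  assumes r: "0 < r"
  obtains \<eta> where "smooth \<eta>" "closure {y. \<eta> y \<noteq> 0} \<subseteq> ball x (2 * r)"
    "\<And>y. y \<in> cball x r \<Longrightarrow> 1 \<le> \<eta> y"
    "\<And>y. 0 \<le> \<eta> y" "\<And>y. \<eta> y \<le> 8 * exp 1" "\<And>y. norm (grad \<eta> y) \<le> 8 * exp 1 / r"
proof
  define \<eta> where "\<eta> y = exp 1 * cutoff 0 x r y" for y
  have grad: "grad \<eta> y = (exp 1 * cutoff 2 x r y * (- 2 / r\<^sup>2)) *\<^sub>R (y - x)" for y
  proof (rule grad_eqI)
    have "GDERIV \<eta> y :> exp 1 *\<^sub>R (exp_inv 2 (2 - (norm (y - x) / r)\<^sup>2) *\<^sub>R ((- 2 / r\<^sup>2) *\<^sub>R (y - x))) + cutoff 0 x r y *\<^sub>R 0"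
      unfolding \<eta>_def using GDERIV_cutoff[of 0 x r y]
      by (intro GDERIV_mult GDERIV_const) (simp add: numeral_2_eq_2)
    then show "GDERIV \<eta> y :> (exp 1 * cutoff 2 x r y * (- 2 / r\<^sup>2)) *\<^sub>R (y - x)"
      by (simp add: cutoff_def mult_ac numeral_2_eq_2)
  qed
  show "smooth \<eta>"
    unfolding smooth_def \<eta>_def by (intro allI C_class_mult C_class_const C_class_cutoff)
  have supp: "norm (y - x) < 3 / 2 * r" if "cutoff m x r y \<noteq> 0" for m y
  proof -
    have "(norm (y - x) / r)\<^sup>2 < 2" using that by (auto simp: cutoff_def exp_inv_def split: if_splits)
    \<comment> \<open>Any number between \<open>sqrt 2\<close> and \<open>2\<close> serves in place of \<open>3 / 2\<close>.\<close>
    also have "2 < (3/2 :: real)\<^sup>2" by (simp add: power2_eq_square)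
    finally have "norm (y - x) / r < 3/2" by (rule power2_less_imp_less) simp
    then show ?thesis using r by (simp add: field_simps)
  qed
  have "closure {y. \<eta> y \<noteq> 0} \<subseteq> cball x (3/2 * r)"
    by (rule closure_minimal) (use supp in \<open>force simp: \<eta>_def dist_norm norm_minus_commute\<close>, simp)
  also have "\<dots> \<subseteq> ball x (2 * r)" using r by auto
  finally show "closure {y. \<eta> y \<noteq> 0} \<subseteq> ball x (2 * r)" .
  show "1 \<le> \<eta> y" if "y \<in> cball x r" for y
  proof -
    define s where "s = 2 - (norm (y - x) / r)\<^sup>2"
    have "norm (y - x) / r \<le> 1" using that r by (simp add: dist_norm norm_minus_commute)
    then have "(norm (y - x) / r)\<^sup>2 \<le> 1\<^sup>2" by (intro power_mono) (use r in auto)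
    then have s: "1 \<le> s" by (simp add: s_def)
    then have "1 \<le> exp (1 - 1 / s)" by simp
    then show ?thesis using s by (simp add: \<eta>_def cutoff_def exp_inv_def s_def[symmetric] flip: exp_add)
  qed
  show "0 \<le> \<eta> y" for y by (simp add: \<eta>_def cutoff_def exp_inv_nonneg)
  show "\<eta> y \<le> 8 * exp 1" for y
    using exp_inv_bound[of 0 "2 - (norm (y - x) / r)\<^sup>2" 0] by (simp add: \<eta>_def cutoff_def)
  show "norm (grad \<eta> y) \<le> 8 * exp 1 / r" for y
  proof (cases "cutoff 2 x r y = 0")
    case False
    have "cutoff 2 x r y \<le> 2"
      using exp_inv_bound[of 2 "2 - (norm (y - x) / r)\<^sup>2" 0] by (simp add: cutoff_def fact_numeral)
    moreover have "0 \<le> cutoff 2 x r y" by (simp add: cutoff_def exp_inv_nonneg)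
    moreover have "norm (y - x) \<le> 2 * r" using supp[OF False] r by simp
    ultimately have "cutoff 2 x r y * norm (y - x) \<le> 2 * (2 * r)"
      by (intro mult_mono) auto
    then have "exp 1 * (2 / r\<^sup>2) * (cutoff 2 x r y * norm (y - x)) \<le> exp 1 * (2 / r\<^sup>2) * (2 * (2 * r))"
      by (intro mult_left_mono) auto
    also have "\<dots> \<le> 8 * exp 1 / r" using r by (simp add: power2_eq_square field_simps)
    also have "exp 1 * (2 / r\<^sup>2) * (cutoff 2 x r y * norm (y - x)) = norm (grad \<eta> y)"
      using \<open>0 \<le> cutoff 2 x r y\<close> by (simp add: grad abs_mult)
    finally show ?thesis .
  qed (use r in \<open>simp add: grad\<close>)
qed

lemma powr_add_le:
  fixes a b p :: real
  assumes "0 \<le> a" "0 \<le> b" "0 \<le> p"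
  shows "(a + b) powr p \<le> 2 powr p * (a powr p + b powr p)"
proof -
  have "(a + b) powr p \<le> (2 * max a b) powr p" using assms by (intro powr_mono2) auto
  also have "\<dots> = 2 powr p * max a b powr p" using assms by (simp add: powr_mult)
  also have "max a b powr p \<le> a powr p + b powr p" by (auto simp: max_def)
  finally show ?thesis by simp
qed

lemma nn_integral_linear_combination:
  fixes f g :: "'a \<Rightarrow> ennreal"
  assumes [measurable]: "f \<in> borel_measurable M" "g \<in> borel_measurable M"
  shows "(\<integral>\<^sup>+y. c * (f y + d * g y) \<partial>M) = c * ((\<integral>\<^sup>+y. f y \<partial>M) + d * (\<integral>\<^sup>+y. g y \<partial>M))"
  by (simp add: nn_integral_cmult nn_integral_add)

lemma ennreal_cancel:
  fixes k :: real
  assumes "0 < k"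
  shows "ennreal k * (ennreal (1 / k) * X) = X" "ennreal (1 / k) * (ennreal k * X) = X"
  using assms by (simp_all flip: mult.assoc ennreal_mult)

text \<open>The cutoff costs a factor \<open>1 / r\<close> and the Poincare inequality on \<open>ball x (2 * r)\<close> gains a factor
  \<open>2 * r\<close>, so the constant does not depend on the scale.\<close>

lemma rel_cap_le_abs_cap:
  fixes S :: "(real^'n) set"
  assumes p: "1 \<le> p" and a: "1 < a" and n: "a * (p - 1) \<le> real (CARD('n) - 1)"
    and r: "0 < r" and S: "S \<subseteq> cball x r"
  shows "rel_cap p S (ball x (2 * r)) \<le>
    ennreal ((16 * exp 1) powr p * (1 + (a - 1) powr (1 - p) * 2 powr p / p)) * abs_cap p S"
    (is "_ \<le> ennreal ?K * _")
proof -
  define A where "A = (a - 1) powr (1 - p) * 2 powr p / p"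
  define C :: real where "C = 8 * exp 1"
  have A: "0 \<le> A" and C: "0 \<le> C" using p by (simp_all add: A_def C_def)
  obtain \<eta> where \<eta>: "smooth \<eta>" "closure {y. \<eta> y \<noteq> 0} \<subseteq> ball x (2 * r)"
    "\<And>y. y \<in> cball x r \<Longrightarrow> 1 \<le> \<eta> y"
    "\<And>y. 0 \<le> \<eta> y" "\<And>y. \<eta> y \<le> C" "\<And>y. norm (grad \<eta> y) \<le> C / r"
    using ball_cutoff_exists[OF r, of x] unfolding C_def by blast
  have bound: "rel_cap p S (ball x (2 * r)) \<le> ennreal ?K * (\<integral>\<^sup>+y\<in>UNIV. ennreal (norm (grad \<phi> y) powr p) \<partial>lborel)"
    if \<phi>: "\<phi> \<in> test_functions UNIV" and ge1: "\<forall>y\<in>S. 1 \<le> \<phi> y" for \<phi>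
  proof -
    have smooth: "smooth \<phi>" using \<phi> by (simp add: test_functions_def)
    have bdd: "bounded {y. \<phi> y \<noteq> 0}"
      using \<phi> bounded_subset[OF compact_imp_bounded closure_subset] by (auto simp: test_functions_def)
    have [measurable]: "\<phi> \<in> borel_measurable borel" "grad \<phi> \<in> borel_measurable borel"
      using smooth by (auto intro!: borel_measurable_continuous_onI smooth_continuous smooth_continuous_grad)
    define \<psi> where "\<psi> y = \<phi> y * \<eta> y" for y
    have supp: "closure {y. \<psi> y \<noteq> 0} \<subseteq> closure {y. \<eta> y \<noteq> 0}"
      by (rule closure_mono) (auto simp: \<psi>_def)
    have "{y. \<psi> y \<noteq> 0} \<subseteq> ball x (2 * r)"
      using closure_subset[of "{y. \<psi> y \<noteq> 0}"] supp \<eta>(2) by blast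
    then have "compact (closure {y. \<psi> y \<noteq> 0})"
      unfolding compact_closure by (rule bounded_subset[OF bounded_ball])
    then have "\<psi> \<in> test_functions (ball x (2 * r))"
      using supp \<eta>(1,2) smooth smooth_mult[of \<phi> \<eta>] by (auto simp: test_functions_def \<psi>_def[abs_def])
    moreover have "1 \<le> \<psi> y" if "y \<in> S" for y
    proof -
      have "1 * 1 \<le> \<phi> y * \<eta> y" using that S ge1 \<eta>(3)[of y] by (intro mult_mono) auto
      then show ?thesis by (simp add: \<psi>_def)
    qed
    ultimately have "rel_cap p S (ball x (2 * r)) \<le> (\<integral>\<^sup>+y\<in>ball x (2 * r). ennreal (norm (grad \<psi> y) powr p) \<partial>lborel)"
      unfolding rel_cap_def by (intro INF_lower) simp
    also have "\<dots> \<le> (\<integral>\<^sup>+y. ennreal ((2 * C) powr p) * (ennreal (norm (grad \<phi> y) powr p) +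
        ennreal (r powr (- p)) * (ennreal (\<bar>\<phi> y\<bar> powr p) * indicator (ball x (2 * r)) y)) \<partial>lborel)"
    proof (intro nn_integral_mono)
      fix y
      have "grad \<psi> y = \<phi> y *\<^sub>R grad \<eta> y + \<eta> y *\<^sub>R grad \<phi> y"
        unfolding \<psi>_def using smooth \<eta>(1) by (intro grad_mult) (metis smooth_def C_class_differentiable)+
      then have "norm (grad \<psi> y) \<le> \<bar>\<phi> y\<bar> * norm (grad \<eta> y) + \<bar>\<eta> y\<bar> * norm (grad \<phi> y)"
        by (metis norm_triangle_ineq norm_scaleR)
      also have "\<dots> \<le> \<bar>\<phi> y\<bar> * (C / r) + C * norm (grad \<phi> y)"
        using \<eta>(4-6)[of y] by (intro add_mono mult_left_mono mult_right_mono) auto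
      also have "\<dots> = C * (norm (grad \<phi> y) + \<bar>\<phi> y\<bar> / r)" by (simp add: algebra_simps)
      finally have "norm (grad \<psi> y) powr p \<le> (C * (norm (grad \<phi> y) + \<bar>\<phi> y\<bar> / r)) powr p"
        using p by (intro powr_mono2) auto
      also have "\<dots> = C powr p * (norm (grad \<phi> y) + \<bar>\<phi> y\<bar> / r) powr p"
        using C r by (simp add: powr_mult)
      also have "\<dots> \<le> C powr p * (2 powr p * (norm (grad \<phi> y) powr p + (\<bar>\<phi> y\<bar> / r) powr p))"
        using p r by (intro mult_left_mono powr_add_le) auto
      also have "\<dots> = (2 * C) powr p * (norm (grad \<phi> y) powr p + r powr (- p) * \<bar>\<phi> y\<bar> powr p)"
        using C r by (simp add: powr_mult powr_divide powr_minus divide_inverse inverse_powr mult_ac)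
      finally have "ennreal (norm (grad \<psi> y) powr p) \<le> ennreal ((2 * C) powr p) *
          (ennreal (norm (grad \<phi> y) powr p) + ennreal (r powr (- p)) * ennreal (\<bar>\<phi> y\<bar> powr p))"
        by (simp flip: ennreal_mult ennreal_plus)
      then show "ennreal (norm (grad \<psi> y) powr p) * indicator (ball x (2 * r)) y \<le>
          ennreal ((2 * C) powr p) * (ennreal (norm (grad \<phi> y) powr p) +
        ennreal (r powr (- p)) * (ennreal (\<bar>\<phi> y\<bar> powr p) * indicator (ball x (2 * r)) y))"
        by (cases "y \<in> ball x (2 * r)") auto
    qed
    also have "\<dots> = ennreal ((2 * C) powr p) * ((\<integral>\<^sup>+y. ennreal (norm (grad \<phi> y) powr p) \<partial>lborel) +
        ennreal (r powr (- p)) * (\<integral>\<^sup>+y\<in>ball x (2 * r). ennreal (\<bar>\<phi> y\<bar> powr p) \<partial>lborel))"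
    proof (rule nn_integral_linear_combination)
      have "(\<lambda>y. ennreal (\<bar>\<phi> y\<bar> powr p)) \<in> borel_measurable lborel" by measurable
      then show "(\<lambda>y. ennreal (\<bar>\<phi> y\<bar> powr p) * indicator (ball x (2 * r)) y) \<in> borel_measurable lborel"
        by (intro borel_measurable_times_ennreal borel_measurable_indicator) simp_all
    qed measurable
    also have "\<dots> \<le> ennreal ((2 * C) powr p) * ((\<integral>\<^sup>+y. ennreal (norm (grad \<phi> y) powr p) \<partial>lborel) +
        ennreal (r powr (- p)) * (ennreal ((a - 1) powr (1 - p) * (2 * r) powr p / p) *
          (\<integral>\<^sup>+y. ennreal (norm (grad \<phi> y) powr p) \<partial>lborel)))"
      using r by (intro mult_left_mono add_left_mono Poincare_ball smooth bdd p a n) auto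
    also have "ennreal (r powr (- p)) * (ennreal ((a - 1) powr (1 - p) * (2 * r) powr p / p) *
          (\<integral>\<^sup>+y. ennreal (norm (grad \<phi> y) powr p) \<partial>lborel)) = ennreal A * (\<integral>\<^sup>+y. ennreal (norm (grad \<phi> y) powr p) \<partial>lborel)"
    proof -
      have "A = r powr (- p) * ((a - 1) powr (1 - p) * (2 * r) powr p / p)"
        using r by (simp add: A_def powr_mult powr_minus)
      then show ?thesis using p by (simp only: ennreal_mult powr_ge_zero mult_nonneg_nonneg divide_nonneg_nonneg mult.assoc)
    qed
    also have "ennreal ((2 * C) powr p) * ((\<integral>\<^sup>+y. ennreal (norm (grad \<phi> y) powr p) \<partial>lborel) +
        ennreal A * (\<integral>\<^sup>+y. ennreal (norm (grad \<phi> y) powr p) \<partial>lborel))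
       = ennreal ((2 * C) powr p * (1 + A)) * (\<integral>\<^sup>+y. ennreal (norm (grad \<phi> y) powr p) \<partial>lborel)"
      using A by (simp add: ennreal_mult distrib_right distrib_left mult.assoc)
    finally show ?thesis by (simp add: A_def C_def)
  qed
  have "1 + A > 0" using A by simp
  then have K: "?K > 0" by (simp add: A_def)
  have inv: "ennreal ?K * (ennreal (1 / ?K) * X) = X" "ennreal (1 / ?K) * (ennreal ?K * X) = X" for X
    using ennreal_cancel[OF K] .
  have "ennreal (1 / ?K) * rel_cap p S (ball x (2 * r)) \<le> abs_cap p S"
    unfolding abs_cap_def rel_cap_def[of p S UNIV]
  proof (rule INF_greatest)
    fix \<phi> assume "\<phi> \<in> {\<phi> \<in> test_functions UNIV. \<forall>y\<in>S. 1 \<le> \<phi> y}"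
    then have "ennreal (1 / ?K) * rel_cap p S (ball x (2 * r)) \<le>
        ennreal (1 / ?K) * (ennreal ?K * (\<integral>\<^sup>+y\<in>UNIV. ennreal (norm (grad \<phi> y) powr p) \<partial>lborel))"
      by (intro mult_left_mono bound) auto
    then show "ennreal (1 / ?K) * rel_cap p S (ball x (2 * r)) \<le>
        (\<integral>\<^sup>+y\<in>UNIV. ennreal (norm (grad \<phi> y) powr p) \<partial>lborel)"
      unfolding inv(2) .
  qed
  then have "ennreal ?K * (ennreal (1 / ?K) * rel_cap p S (ball x (2 * r))) \<le> ennreal ?K * abs_cap p S"
    by (rule mult_left_mono) simp
  then show ?thesis unfolding inv(1) .
qed

text \<open>The choice of the Jensen exponent: \<open>a = (N - 1) / (p - 1)\<close> exceeds \<open>1\<close> exactly because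
  \<open>p < N\<close>; for \<open>p = 1\<close> the condition on \<open>a\<close> is void beyond \<open>a > 1\<close>.\<close>

lemma capacities_comparable:
  assumes "(1 \<le> p \<and> p < real CARD('n)) \<or> (p = 1 \<and> CARD('n) = 1)"
  obtains K where "1 \<le> K" "\<And>S x r. 0 < r \<Longrightarrow> (S :: (real^'n) set) \<subseteq> cball x r \<Longrightarrow>
    rel_cap p S (ball x (2 * r)) \<le> ennreal K * abs_cap p S"
proof -
  have p: "1 \<le> p" using assms by auto
  obtain a where a: "1 < a" "a * (p - 1) \<le> real (CARD('n) - 1)"
  proof (cases "p = 1")
    case True
    then show ?thesis using that[of 2] by simp
  next
    case False
    then have "1 < p" "p < real CARD('n)" using assms by auto
    then show ?thesis using that[of "(real CARD('n) - 1) / (p - 1)"] by (simp add: of_nat_diff)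
  qed
  define K where "K = (16 * exp 1) powr p * (1 + (a - 1) powr (1 - p) * 2 powr p / p)"
  have "1 \<le> (16 * exp (1::real)) powr p"
    using p by (intro ge_one_powr_ge_zero) (use exp_ge_add_one_self[of "1::real"] in auto)
  then have "1 * 1 \<le> K"
    unfolding K_def using p by (intro mult_mono) auto
  then have "1 \<le> K" by simp
  then show ?thesis
    by (rule that) (unfold K_def, rule rel_cap_le_abs_cap[OF p a])
qed

section \<open>Comparison of the two inradii\<close>

lemma MS_inradius_le_cap_inradius:
  fixes \<Omega> :: "(real^'n) set"
  assumes K: "0 \<le> K" and cap: "\<And>x r. 0 < r \<Longrightarrow>
      rel_cap p (cball x r - \<Omega>) (ball x (2 * r)) \<le> ennreal K * abs_cap p (cball x r - \<Omega>)"
    and \<delta>: "0 \<le> \<delta>" "K * \<delta> \<le> \<gamma>"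
  shows "MS_inradius p \<delta> \<Omega> \<le> cap_inradius p \<gamma> \<Omega>"
  unfolding MS_inradius_def cap_inradius_def
proof (intro SUP_subset_mono subsetI order.refl)
  fix r assume "r \<in> {r. 0 < r \<and> (\<exists>x. abs_cap p (cball x r - \<Omega>) \<le> ennreal \<delta> * abs_cap p (cball x r))}"
  then obtain x where r: "0 < r" and x: "abs_cap p (cball x r - \<Omega>) \<le> ennreal \<delta> * abs_cap p (cball x r)"
    by auto
  have "rel_cap p (cball x r - \<Omega>) (ball x (2 * r)) \<le> ennreal K * abs_cap p (cball x r - \<Omega>)"
    using cap[OF r] .
  also have "\<dots> \<le> ennreal K * (ennreal \<delta> * rel_cap p (cball x r) (ball x (2 * r)))"
    by (intro mult_left_mono order.trans[OF x] abs_cap_le_rel_cap) auto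
  also have "\<dots> = ennreal (K * \<delta>) * rel_cap p (cball x r) (ball x (2 * r))"
    using K \<delta> by (simp add: ennreal_mult mult.assoc)
  also have "\<dots> \<le> ennreal \<gamma> * rel_cap p (cball x r) (ball x (2 * r))"
    by (intro mult_right_mono ennreal_leI \<delta>) simp
  finally show "r \<in> {r. 0 < r \<and> (\<exists>x. rel_cap p (cball x r - \<Omega>) (ball x (2 * r)) \<le> ennreal \<gamma> * rel_cap p (cball x r) (ball x (2 * r)))}"
    using r by auto
qed

lemma cap_inradius_le_MS_inradius:
  fixes \<Omega> :: "(real^'n) set"
  assumes K: "0 \<le> K" and cap: "\<And>(x :: real^'n) r. 0 < r \<Longrightarrow>
      rel_cap p (cball x r) (ball x (2 * r)) \<le> ennreal K * abs_cap p (cball x r)"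
    and \<gamma>: "0 \<le> \<gamma>" "K * \<gamma> \<le> \<delta>"
  shows "cap_inradius p \<gamma> \<Omega> \<le> MS_inradius p \<delta> \<Omega>"
  unfolding MS_inradius_def cap_inradius_def
proof (intro SUP_subset_mono subsetI order.refl)
  fix r assume "r \<in> {r. 0 < r \<and> (\<exists>x. rel_cap p (cball x r - \<Omega>) (ball x (2 * r)) \<le> ennreal \<gamma> * rel_cap p (cball x r) (ball x (2 * r)))}"
  then obtain x where r: "0 < r" and x: "rel_cap p (cball x r - \<Omega>) (ball x (2 * r)) \<le> ennreal \<gamma> * rel_cap p (cball x r) (ball x (2 * r))"
    by auto
  have "abs_cap p (cball x r - \<Omega>) \<le> ennreal \<gamma> * rel_cap p (cball x r) (ball x (2 * r))"
    using abs_cap_le_rel_cap x by (rule order.trans)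
  also have "\<dots> \<le> ennreal \<gamma> * (ennreal K * abs_cap p (cball x r))"
    by (rule mult_left_mono[OF cap[OF r]]) simp
  also have "\<dots> = ennreal (K * \<gamma>) * abs_cap p (cball x r)"
    using K \<gamma> by (simp add: ennreal_mult mult_ac)
  also have "\<dots> \<le> ennreal \<delta> * abs_cap p (cball x r)"
    by (intro mult_right_mono ennreal_leI \<gamma>) simp
  finally show "r \<in> {r. 0 < r \<and> (\<exists>x. abs_cap p (cball x r - \<Omega>) \<le> ennreal \<delta> * abs_cap p (cball x r))}"
    using r by auto
qed

theorem proposition4p7:
  shows "\<exists>\<alpha> \<beta> :: real \<Rightarrow> real.
    (\<forall>p. (1 \<le> p \<and> p < real CARD('n)) \<or> (p = 1 \<and> CARD('n) = 1) \<longrightarrow>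
       0 < \<alpha> p \<and> \<alpha> p \<le> 1 \<and> 1 \<le> \<beta> p \<and>
       (\<forall>\<Omega> :: (real^'n) set. open \<Omega> \<longrightarrow>
          (\<forall>\<gamma>. 0 < \<gamma> \<and> \<gamma> < 1 \<longrightarrow> MS_inradius p (\<alpha> p * \<gamma>) \<Omega> \<le> cap_inradius p \<gamma> \<Omega>) \<and>
          (\<forall>\<gamma>. 0 < \<gamma> \<and> \<gamma> < 1 / \<beta> p \<longrightarrow> cap_inradius p \<gamma> \<Omega> \<le> MS_inradius p (\<beta> p * \<gamma>) \<Omega>))) \<and>
    (CARD('n) \<ge> 2 \<longrightarrow>
       (\<alpha> \<longlongrightarrow> 0) (at_left (real CARD('n))) \<and>
       filterlim \<beta> at_top (at_left (real CARD('n))))"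
proof -
  let ?adm = "\<lambda>p. (1 \<le> p \<and> p < real CARD('n)) \<or> (p = 1 \<and> CARD('n) = 1)"
  have "\<forall>p. \<exists>K. ?adm p \<longrightarrow> 1 \<le> K \<and> (\<forall>S x r. 0 < r \<longrightarrow> (S :: (real^'n) set) \<subseteq> cball x r \<longrightarrow>
    rel_cap p S (ball x (2 * r)) \<le> ennreal K * abs_cap p S)"
    using capacities_comparable by (metis (no_types, lifting))
  then obtain K where K1: "\<And>p. ?adm p \<Longrightarrow> 1 \<le> K p"
    and K: "\<And>p S x r. ?adm p \<Longrightarrow> 0 < r \<Longrightarrow> (S :: (real^'n) set) \<subseteq> cball x r \<Longrightarrow>
      rel_cap p S (ball x (2 * r)) \<le> ennreal (K p) * abs_cap p S"
    by metis
  \<comment> \<open>The last argument of the maximum only serves to force the limits at \<open>p = N\<close>.\<close>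
  define L where "L p = max (max 1 (K p)) (1 / (real CARD('n) - p))" for p
  have L: "1 \<le> L p" "K p \<le> L p" for p by (auto simp: L_def)
  have lim: "filterlim L at_top (at_left (real CARD('n)))"
  proof (rule filterlim_at_top_mono)
    show "filterlim (\<lambda>p. 1 / (real CARD('n) - p)) at_top (at_left (real CARD('n)))"
      unfolding inverse_eq_divide[symmetric]
      by (rule filterlim_inverse_at_top)
         (auto intro!: tendsto_eq_intros simp: eventually_at_left_field intro: lt_ex)
    show "eventually (\<lambda>p. 1 / (real CARD('n) - p) \<le> L p) (at_left (real CARD('n)))"
      by (simp add: L_def)
  qed
  show ?thesis
  proof (rule exI[of _ "\<lambda>p. inverse (L p)"], rule exI[of _ L], intro conjI allI impI)
    fix p assume "?adm p"
    note K1 = K1[OF this] and K = K[OF this]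
    show "0 < inverse (L p)" "inverse (L p) \<le> 1" "1 \<le> L p"
      using L(1)[of p] by (auto intro: inverse_le_1_iff[THEN iffD2])
    fix \<Omega> :: "(real^'n) set" and \<gamma> :: real
    show "MS_inradius p (inverse (L p) * \<gamma>) \<Omega> \<le> cap_inradius p \<gamma> \<Omega>" if "0 < \<gamma> \<and> \<gamma> < 1"
      using that K1 L[of p]
      by (intro MS_inradius_le_cap_inradius[of "K p"] K) (auto simp: field_simps)
    show "cap_inradius p \<gamma> \<Omega> \<le> MS_inradius p (L p * \<gamma>) \<Omega>" if "0 < \<gamma> \<and> \<gamma> < 1 / L p"
      using that K1 L[of p]
      by (intro cap_inradius_le_MS_inradius[of "K p"] K) auto
  next
    show "((\<lambda>p. inverse (L p)) \<longlongrightarrow> 0) (at_left (real CARD('n)))"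
      by (rule tendsto_inverse_0_at_top[OF lim])
  qed (rule lim)
qed

end
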